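(* For every $k\ge1$, the graph property of $k$-colourability admits a size-oblivious one-sided error tester with query complexity $\widetilde O(k^6/\varepsilon^6)$.
   Context: A graph is a finite simple labelled graph; it is $k$-colourable if its vertex set can be partitioned into $k$ (possibly empty) independent sets. Distance: for graphs $G,G'$ on the same $n$-element vertex set, $\mathrm{dist}(G,G')=|E(G)\triangle E(G')|/n^2$; $G$ is $\varepsilon$-far from a graph property $\Pi$ if the minimum of $\mathrm{dist}(G,G')$ over $G'\in\Pi$ with $V(G')=V(G)$ exceeds $\varepsilon$. A size-oblivious tester for $\Pi$ is a randomized oracle algorithm which, given $\varepsilon>0$ but not $|V(G)|$, has oracle access to the adjacency predicate of $G$ and to independent uniform samples from $V(G)$ (a request for a sample larger than the input being interpreted as a request to inspect the whole graph), accepts every $G\in\Pi$ with probability at least $2/3$, and rejects every $G$ that is $\varepsilon$-far from $\Pi$ with probability at least $2/3$. Its query complexity is the maximum number of adjacency queries and its sample complexity the maximum number of vertex labels inspected; both must be bounded in terms of $\varepsilon$ only. It has one-sided error if it accepts every graph in $\Pi$ with probability one. $\widetilde O(\cdot)$ hides polylogarithmic factors in the displayed quantities. *)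

theory Defs
  imports "HOL-Probability.Probability" "HOL-Library.Disjoint_Sets"
begin

type_synonym ugraph = "nat set \<times> nat set set"

abbreviation verts :: "ugraph \<Rightarrow> nat set" where "verts \<equiv> fst"
abbreviation edges :: "ugraph \<Rightarrow> nat set set" where "edges \<equiv> snd"

definition simple_graph :: "ugraph \<Rightarrow> bool" where
  "simple_graph G \<longleftrightarrow> finite (verts G) \<and> edges G \<subseteq> {e. e \<subseteq> verts G \<and> card e = 2}"

definition adjacent :: "ugraph \<Rightarrow> nat \<Rightarrow> nat \<Rightarrow> bool" where
  "adjacent G u v \<longleftrightarrow> {u, v} \<in> edges G"

definition independent_set :: "ugraph \<Rightarrow> nat set \<Rightarrow> bool" where
  "independent_set G S \<longleftrightarrow> S \<subseteq> verts G \<and> (\<forall>u\<in>S. \<forall>v\<in>S. \<not> adjacent G u v)"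

definition colourable :: "nat \<Rightarrow> ugraph \<Rightarrow> bool" where
  "colourable k G \<longleftrightarrow>
     (\<exists>P :: nat \<Rightarrow> nat set. (\<Union>i<k. P i) = verts G \<and> disjoint_family_on P {..<k} \<and>
        (\<forall>i<k. independent_set G (P i)))"

text \<open>On the graph without vertices the quotient is \<open>0 / 0 = 0\<close>.\<close>

definition graph_dist :: "ugraph \<Rightarrow> ugraph \<Rightarrow> real" where
  "graph_dist G G' = real (card (sym_diff (edges G) (edges G'))) / real (card (verts G)) ^ 2"

text \<open>The minimum is over a finite set, so it exceeds \<open>\<epsilon>\<close> iff every member does; a graph with
  no member of the property on its vertex set is far from it.\<close>

definition eps_far :: "(ugraph \<Rightarrow> bool) \<Rightarrow> real \<Rightarrow> ugraph \<Rightarrow> bool" where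
  "eps_far P \<epsilon> G \<longleftrightarrow>
     (\<forall>G'. simple_graph G' \<and> verts G' = verts G \<and> P G' \<longrightarrow> graph_dist G G' > \<epsilon>)"

text \<open>Randomized, adaptive oracle algorithms, as decision trees whose nodes toss a fair coin,
  request a sample of a given size, or query the adjacency of two labels. A tree has no access to
  the graph except through the answers it receives; in particular it does not know the number of
  vertices.\<close>

datatype oracle_alg =
    Halt bool \<comment> \<open>\<open>True\<close> means accept\<close>
  | Toss "bool \<Rightarrow> oracle_alg"
  | Sample nat "nat list \<Rightarrow> oracle_alg"
  | Query nat nat "bool \<Rightarrow> oracle_alg"

text \<open>A request for more vertices than there are is answered by the whole vertex set (which the
  algorithm recognizes from the length of the answer); the adjacencies of the graph must still be
  queried, and paid for, one by one.\<close>

definition sample_answer :: "ugraph \<Rightarrow> nat \<Rightarrow> nat list pmf" where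
  "sample_answer G s =
     (if s > card (verts G) then return_pmf (sorted_list_of_set (verts G))
      else replicate_pmf s (pmf_of_set (verts G)))"

text \<open>Joint distribution of the verdict, the number of adjacency queries, and the number of vertex
  labels received (counted with multiplicity).\<close>

primrec run :: "ugraph \<Rightarrow> oracle_alg \<Rightarrow> (bool \<times> nat \<times> nat) pmf" where
  "run G (Halt b) = return_pmf (b, 0, 0)"
| "run G (Toss f) = bind_pmf (bernoulli_pmf (1/2)) (\<lambda>c. run G (f c))"
| "run G (Sample s f) =
     bind_pmf (sample_answer G s)
       (\<lambda>xs. map_pmf (\<lambda>(b, q, l). (b, q, l + length xs)) (run G (f xs)))"
| "run G (Query u v f) = map_pmf (\<lambda>(b, q, l). (b, Suc q, l)) (run G (f (adjacent G u v)))"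

definition accept_prob :: "oracle_alg \<Rightarrow> ugraph \<Rightarrow> real" where
  "accept_prob A G = measure_pmf.prob (run G A) {(b, q, l). b}"

definition reject_prob :: "oracle_alg \<Rightarrow> ugraph \<Rightarrow> real" where
  "reject_prob A G = measure_pmf.prob (run G A) {(b, q, l). \<not> b}"

definition query_counts :: "oracle_alg \<Rightarrow> nat set" where
  "query_counts A = {q. \<exists>G b l. simple_graph G \<and> (b, q, l) \<in> set_pmf (run G A)}"

definition sample_counts :: "oracle_alg \<Rightarrow> nat set" where
  "sample_counts A = {l. \<exists>G b q. simple_graph G \<and> (b, q, l) \<in> set_pmf (run G A)}"

text \<open>The supremum is a maximum, and meaningful, only when the set is bounded, which
  \<open>size_oblivious_tester\<close> below requires.\<close>

definition query_complexity :: "oracle_alg \<Rightarrow> nat" where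
  "query_complexity A = Sup (query_counts A)"

definition size_oblivious_tester :: "(ugraph \<Rightarrow> bool) \<Rightarrow> (real \<Rightarrow> oracle_alg) \<Rightarrow> bool" where
  "size_oblivious_tester P T \<longleftrightarrow>
     (\<forall>\<epsilon>>0.
        bdd_above (query_counts (T \<epsilon>)) \<and> bdd_above (sample_counts (T \<epsilon>)) \<and>
        (\<forall>G. simple_graph G \<and> P G \<longrightarrow> accept_prob (T \<epsilon>) G \<ge> 2/3) \<and>
        (\<forall>G. simple_graph G \<and> eps_far P \<epsilon> G \<longrightarrow> reject_prob (T \<epsilon>) G \<ge> 2/3))"

definition one_sided_error :: "(ugraph \<Rightarrow> bool) \<Rightarrow> (real \<Rightarrow> oracle_alg) \<Rightarrow> bool" where
  "one_sided_error P T \<longleftrightarrow>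
     (\<forall>\<epsilon>>0. \<forall>G. simple_graph G \<and> P G \<longrightarrow> accept_prob (T \<epsilon>) G = 1)"

text \<open>\<open>f = O(g * polylog g)\<close>, uniformly on \<open>S\<close>; the summand \<open>2\<close> keeps the logarithm away
  from \<open>0\<close>.\<close>

definition soft_O_on :: "'a set \<Rightarrow> ('a \<Rightarrow> real) \<Rightarrow> ('a \<Rightarrow> real) \<Rightarrow> bool" where
  "soft_O_on S f g \<longleftrightarrow>
     (\<exists>(C::real) (d::nat). \<forall>x\<in>S. \<bar>f x\<bar> \<le> C * \<bar>g x\<bar> * ln (2 + \<bar>g x\<bar>) ^ d)"

end

theory Submission
  imports Defs
begin

text \<open>
  The tester draws \<open>s = \<lceil>16 k\<^sup>2 / \<epsilon>\<^sup>2\<rceil>\<close> vertices, queries all pairs among them, and accepts iff the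
  induced subgraph is \<open>k\<close>-colourable. Colourability is hereditary, so the error is one-sided, and the
  number of queries is \<open>s\<^sup>2 = O(k\<^sup>4 / \<epsilon>\<^sup>4)\<close>. For \<open>\<epsilon> \<ge> 1\<close> no graph is \<open>\<epsilon>\<close>-far, and the tester accepts
  blindly; for large \<open>\<epsilon>\<close> it has to, because the bound on the queries tends to \<open>0\<close> as \<open>\<epsilon>\<close> grows.

  It remains to see that a sample from an \<open>\<epsilon>\<close>-far graph \<open>G\<close> on \<open>n\<close> vertices is rarely colourable.
  Reveal the sampled vertices one at a time, and let \<open>\<phi>\<close> record the colours of some of those already
  seen. A colour is available at \<open>v\<close> if no recorded neighbour of \<open>v\<close> has it. Call \<open>v\<close> restricting if
  each colour available at \<open>v\<close> is also available at \<open>\<epsilon>n/2\<close> or more neighbours of \<open>v\<close>.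

  \<^item> There are always at least \<open>\<epsilon>n/2\<close> restricting vertices (\<open>many_restricting\<close>): otherwise, give each
    other vertex an available colour that violates the condition. The monochromatic edges number at
    most \<open>\<epsilon>n\<^sup>2/2\<close> at restricting vertices and \<open>\<epsilon>n\<^sup>2/2\<close> elsewhere, and deleting them shows that \<open>G\<close>
    is not \<open>\<epsilon>\<close>-far.

  \<^item> Recording a colour at a restricting vertex lowers the total number of available colours, at most
    \<open>kn\<close>, by \<open>\<epsilon>n/2\<close> (\<open>freedom_decreases\<close>), and hence can happen at most \<open>2k/\<epsilon>\<close> times.

  So with probability at least \<open>\<epsilon>/2\<close> a sample forces a choice among at most \<open>k\<close> colours, and only
  \<open>2k/\<epsilon>\<close> such choices are possible. Charging a factor \<open>2k\<close> for each of them absorbs the union bound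
  over the colours and still gains a factor \<open>1/2\<close>; therefore each sample shrinks the bound on the
  probability that \<open>\<phi>\<close> extends to the sample by a factor \<open>1 - \<epsilon>/4\<close> (\<open>prob_extendable_le\<close>). The
  resulting bound \<open>(2k) powr (2k/\<epsilon>) * (1 - \<epsilon>/4) ^ s\<close> is at most \<open>1/3\<close> (\<open>sample_size_suffices\<close>). If
  \<open>s > n\<close>, the sample is the whole vertex set, and the verdict is exact.
\<close>

section \<open>Proper colourings and distance from colourability\<close>

definition proper_on :: "nat \<Rightarrow> ugraph \<Rightarrow> nat set \<Rightarrow> (nat \<Rightarrow> nat) \<Rightarrow> bool" where
  "proper_on k G S c \<longleftrightarrow>
     (\<forall>v\<in>S. c v < k) \<and> (\<forall>u\<in>S. \<forall>v\<in>S. adjacent G u v \<longrightarrow> c u \<noteq> c v)"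

lemma proper_on_subset: "proper_on k G T c \<Longrightarrow> S \<subseteq> T \<Longrightarrow> proper_on k G S c"
  by (auto simp: proper_on_def)

lemma colourable_iff_proper_on: "colourable k G \<longleftrightarrow> (\<exists>c. proper_on k G (verts G) c)"
proof
  assume "colourable k G"
  then obtain P where P: "(\<Union>i<k. P i) = verts G" "\<forall>i<k. independent_set G (P i)"
    unfolding colourable_def by blast
  have "\<forall>v. \<exists>i. v \<in> verts G \<longrightarrow> i < k \<and> v \<in> P i"
    using P(1) by blast
  then obtain c where c: "\<And>v. v \<in> verts G \<Longrightarrow> c v < k \<and> v \<in> P (c v)"
    by metis
  have "proper_on k G (verts G) c"
    unfolding proper_on_def using c P(2) unfolding independent_set_def by metis
  then show "\<exists>c. proper_on k G (verts G) c"
    by blast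
next
  assume "\<exists>c. proper_on k G (verts G) c"
  then obtain c where c: "proper_on k G (verts G) c" ..
  show "colourable k G"
    unfolding colourable_def
  proof (intro exI[of _ "\<lambda>i. {v \<in> verts G. c v = i}"] conjI)
    show "(\<Union>i<k. {v \<in> verts G. c v = i}) = verts G"
      using c by (auto simp: proper_on_def)
    show "disjoint_family_on (\<lambda>i. {v \<in> verts G. c v = i}) {..<k}"
      by (auto simp: disjoint_family_on_def)
    show "\<forall>i<k. independent_set G {v \<in> verts G. c v = i}"
      using c unfolding proper_on_def independent_set_def by fastforce
  qed
qed

lemma simple_graph_edgeE:
  assumes "simple_graph G" "e \<in> edges G"
  obtains u v where "e = {u, v}" "u \<in> verts G" "v \<in> verts G"
proof -
  have "card e = 2" "e \<subseteq> verts G"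
    using assms by (auto simp: simple_graph_def)
  then obtain u v where "e = {u, v}"
    by (auto simp: card_2_iff)
  with \<open>e \<subseteq> verts G\<close> show thesis
    by (intro that[of u v]) auto
qed

lemma not_colourable_if_eps_far:
  assumes "simple_graph G" "\<epsilon> > 0" "eps_far P \<epsilon> G"
  shows "\<not> P G"
proof
  assume "P G"
  then have "graph_dist G G > \<epsilon>"
    using assms unfolding eps_far_def by blast
  then show False
    using assms(2) by (simp add: graph_dist_def)
qed

text \<open>The graph to compare \<open>G\<close> with is \<open>G\<close> without the monochromatic edges.\<close>

lemma eps_far_imp_many_monochromatic_edges:
  assumes G: "simple_graph G" and pos: "\<epsilon> > 0" and far: "eps_far (colourable k) \<epsilon> G"
    and c: "\<And>v. v \<in> verts G \<Longrightarrow> c v < k"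
  shows "\<epsilon> * real (card (verts G)) ^ 2 < real (card {e \<in> edges G. \<exists>u v. e = {u, v} \<and> c u = c v})"
    (is "_ < real (card ?M)")
proof -
  let ?G' = "(verts G, edges G - ?M)"
  have simple: "simple_graph ?G'"
    using G by (auto simp: simple_graph_def)
  have "proper_on k ?G' (verts G) c"
    using c by (auto simp: proper_on_def adjacent_def)
  then have "colourable k ?G'"
    by (auto simp: colourable_iff_proper_on)
  with far simple have "graph_dist G ?G' > \<epsilon>"
    unfolding eps_far_def by simp
  moreover have "sym_diff (edges G) (edges ?G') = ?M"
    by auto
  ultimately have *: "real (card ?M) / real (card (verts G)) ^ 2 > \<epsilon>"
    unfolding graph_dist_def by simp
  have "card (verts G) \<noteq> 0"
    using * pos by (intro notI) simp
  then show ?thesis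
    using * by (simp add: field_simps)
qed

text \<open>Under the constant colouring every edge is monochromatic, and there are at most \<open>n\<^sup>2\<close> edges.\<close>

lemma not_eps_far_if_ge_1:
  assumes G: "simple_graph G" and "k \<ge> 1" "\<epsilon> \<ge> 1"
  shows "\<not> eps_far (colourable k) \<epsilon> G"
proof
  assume far: "eps_far (colourable k) \<epsilon> G"
  \<comment> \<open>The trivial equation is what \<open>c u = c v\<close> becomes for the constant colouring.\<close>
  let ?M = "{e \<in> edges G. \<exists>u v. e = {u, v} \<and> (0::nat) = 0}"
  have fin: "finite (verts G)"
    using G by (simp add: simple_graph_def)
  have "?M \<subseteq> (\<lambda>(u, v). {u, v}) ` (verts G \<times> verts G)"
  proof
    fix e assume "e \<in> ?M"
    then have "e \<in> edges G"
      by simp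
    then obtain u v where "e = {u, v}" "u \<in> verts G" "v \<in> verts G"
      by (rule simple_graph_edgeE[OF G])
    then show "e \<in> (\<lambda>(u, v). {u, v}) ` (verts G \<times> verts G)"
      by (intro image_eqI[of _ _ "(u, v)"]) auto
  qed
  then have "card ?M \<le> card (verts G \<times> verts G)"
    using fin by (intro surj_card_le) auto
  then have "real (card ?M) \<le> 1 * real (card (verts G)) ^ 2"
    by (simp add: card_cartesian_product power2_eq_square flip: of_nat_mult)
  also have "\<dots> \<le> \<epsilon> * real (card (verts G)) ^ 2"
    using assms by (intro mult_right_mono) auto
  also have "\<dots> < real (card ?M)"
    using eps_far_imp_many_monochromatic_edges[OF G _ far, of "\<lambda>_. 0"] assms by simp
  finally show False
    by simp
qed

section \<open>Partial colourings and restricting vertices\<close>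

text \<open>A partial colouring \<open>\<phi>\<close> is a set of pairs \<open>(v, i)\<close> of a vertex and its colour. A vertex drawn
  repeatedly can be recorded with different colours; then no proper colouring extends \<open>\<phi>\<close>.\<close>

definition available :: "nat \<Rightarrow> ugraph \<Rightarrow> (nat \<times> nat) set \<Rightarrow> nat \<Rightarrow> nat set" where
  "available k G \<phi> u = {i. i < k \<and> \<not> (\<exists>v. (v, i) \<in> \<phi> \<and> adjacent G u v)}"

definition available_nbrs :: "nat \<Rightarrow> ugraph \<Rightarrow> (nat \<times> nat) set \<Rightarrow> nat \<Rightarrow> nat \<Rightarrow> nat set" where
  "available_nbrs k G \<phi> v i = {u \<in> verts G. adjacent G u v \<and> i \<in> available k G \<phi> u}"

text \<open>A vertex without available colours is restricting: it refutes the partial colouring at once.\<close>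

definition restricting :: "nat \<Rightarrow> real \<Rightarrow> ugraph \<Rightarrow> (nat \<times> nat) set \<Rightarrow> nat set" where
  "restricting k \<epsilon> G \<phi> =
     {v \<in> verts G. \<forall>i\<in>available k G \<phi> v.
        \<epsilon> / 2 * real (card (verts G)) \<le> real (card (available_nbrs k G \<phi> v i))}"

definition freedom :: "nat \<Rightarrow> ugraph \<Rightarrow> (nat \<times> nat) set \<Rightarrow> nat" where
  "freedom k G \<phi> = (\<Sum>u\<in>verts G. card (available k G \<phi> u))"

lemma finite_available [simp]: "finite (available k G \<phi> u)"
  by (rule finite_subset[of _ "{..<k}"]) (auto simp: available_def)

lemma card_available_le: "card (available k G \<phi> u) \<le> k"
proof -
  have "card (available k G \<phi> u) \<le> card {..<k}"
    by (intro card_mono) (auto simp: available_def)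
  then show ?thesis
    by simp
qed

text \<open>Colour every vertex that is not restricting by an available colour shared with few neighbours.
  A monochromatic edge that avoids the restricting vertices then joins a vertex to one of these
  neighbours, and far graphs have too many monochromatic edges for all of them to be of this kind.\<close>

lemma many_restricting:
  assumes G: "simple_graph G" and k: "k \<ge> 1" and pos: "\<epsilon> > 0"
    and far: "eps_far (colourable k) \<epsilon> G"
  shows "\<epsilon> / 2 * real (card (verts G)) \<le> real (card (restricting k \<epsilon> G \<phi>))"
proof -
  let ?V = "verts G" and ?W = "restricting k \<epsilon> G \<phi>"
  define n where "n = real (card ?V)"
  have fin: "finite ?V"
    using G by (simp add: simple_graph_def)
  have WV: "?W \<subseteq> ?V"
    by (auto simp: restricting_def)
  then have finW: "finite ?W"
    using fin finite_subset by blast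
  have "\<forall>v. \<exists>i. v \<in> ?V - ?W \<longrightarrow>
      i \<in> available k G \<phi> v \<and> real (card (available_nbrs k G \<phi> v i)) \<le> \<epsilon> / 2 * n"
    by (force simp: restricting_def n_def not_le)
  then obtain c' where c': "\<And>v. v \<in> ?V - ?W \<Longrightarrow> c' v \<in> available k G \<phi> v"
      "\<And>v. v \<in> ?V - ?W \<Longrightarrow> real (card (available_nbrs k G \<phi> v (c' v))) \<le> \<epsilon> / 2 * n"
    by metis
  \<comment> \<open>The edges at restricting vertices are written off as a whole, so any colour serves there.\<close>
  define c where "c v = (if v \<in> ?W then 0 else c' v)" for v
  have c: "c v < k" if "v \<in> ?V" for v
    using c'(1)[of v] that k by (auto simp: c_def available_def)
  define M where "M = {e \<in> edges G. \<exists>u v. e = {u, v} \<and> c u = c v}"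
  define R where "R = (SIGMA v:?V - ?W. available_nbrs k G \<phi> v (c' v))"
  have finR: "finite R"
    unfolding R_def using fin by (auto simp: available_nbrs_def)
  have "M \<subseteq> (\<lambda>(u, v). {u, v}) ` (?W \<times> ?V \<union> R)"
  proof
    fix e assume "e \<in> M"
    then have e: "e \<in> edges G" and "\<exists>u v. e = {u, v} \<and> c u = c v"
      by (auto simp: M_def)
    then obtain u v where uv: "e = {u, v}" "c u = c v"
      by blast
    have V: "u \<in> ?V" "v \<in> ?V"
      using G e uv by (auto simp: simple_graph_def)
    consider "u \<in> ?W" | "v \<in> ?W" | "u \<notin> ?W" "v \<notin> ?W"
      by blast
    then show "e \<in> (\<lambda>(u, v). {u, v}) ` (?W \<times> ?V \<union> R)"
    proof cases
      case 1
      then show ?thesis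
        using V uv by (intro image_eqI[of _ _ "(u, v)"]) auto
    next
      case 2
      then show ?thesis
        using V uv by (intro image_eqI[of _ _ "(v, u)"]) auto
    next
      case 3
      then have "v \<in> available_nbrs k G \<phi> u (c' u)"
        using c'(1)[of v] V uv e
        by (auto simp: available_nbrs_def c_def adjacent_def insert_commute)
      then show ?thesis
        using 3 V uv by (intro image_eqI[of _ _ "(u, v)"]) (auto simp: R_def)
    qed
  qed
  then have "card M \<le> card ((\<lambda>(u, v). {u, v}) ` (?W \<times> ?V \<union> R))"
    using fin finW finR by (intro card_mono) auto
  also have "\<dots> \<le> card (?W \<times> ?V \<union> R)"
    using fin finW finR by (intro card_image_le) auto
  also have "\<dots> \<le> card (?W \<times> ?V) + card R"
    by (rule card_Un_le)
  finally have "real (card M) \<le> real (card ?W) * n + real (card R)"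
    by (simp add: card_cartesian_product n_def flip: of_nat_mult of_nat_add)
  also have "real (card R) = (\<Sum>v\<in>?V - ?W. real (card (available_nbrs k G \<phi> v (c' v))))"
    unfolding R_def using fin by (subst card_SigmaI) (auto simp: available_nbrs_def)
  also have "\<dots> \<le> (\<Sum>v\<in>?V - ?W. \<epsilon> / 2 * n)"
    using c'(2) by (rule sum_mono)
  also have "\<dots> \<le> n * (\<epsilon> / 2 * n)"
    using pos fin unfolding sum_constant n_def
    by (intro mult_right_mono) (auto intro: card_mono)
  finally have upper: "real (card M) \<le> real (card ?W) * n + \<epsilon> / 2 * n\<^sup>2"
    by (simp add: power2_eq_square algebra_simps)
  have "\<epsilon> * n\<^sup>2 < real (card M)"
    unfolding M_def n_def
    by (rule eps_far_imp_many_monochromatic_edges[OF G pos far]) (use c in auto)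
  with upper have "(\<epsilon> / 2 * n) * n < real (card ?W) * n"
    by (simp add: power2_eq_square algebra_simps)
  then have "\<epsilon> / 2 * n < real (card ?W)"
    by (rule mult_right_less_imp_less) (simp add: n_def)
  then show ?thesis
    by (simp add: n_def)
qed

lemma available_insert:
  "available k G (insert (x, i) \<phi>) u =
     (if adjacent G u x then available k G \<phi> u - {i} else available k G \<phi> u)"
  by (auto simp: available_def)

text \<open>Recording colour \<open>i\<close> at \<open>x\<close> removes \<open>i\<close> from exactly the neighbours of \<open>x\<close> that had it.\<close>

lemma freedom_decreases:
  assumes G: "simple_graph G" and x: "x \<in> restricting k \<epsilon> G \<phi>" and i: "i \<in> available k G \<phi> x"
  shows "real (freedom k G (insert (x, i) \<phi>)) + \<epsilon> / 2 * real (card (verts G))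
           \<le> real (freedom k G \<phi>)"
proof -
  have fin: "finite (verts G)"
    using G by (simp add: simple_graph_def)
  have split: "card (available k G (insert (x, i) \<phi>) u)
      + (if u \<in> available_nbrs k G \<phi> x i then 1 else 0) = card (available k G \<phi> u)"
    if u: "u \<in> verts G" for u
  proof (cases "u \<in> available_nbrs k G \<phi> x i")
    case True
    then have "adjacent G u x" "i \<in> available k G \<phi> u"
      by (auto simp: available_nbrs_def)
    then show ?thesis
      using True card_Suc_Diff1[of "available k G \<phi> u" i] by (simp add: available_insert)
  next
    case False
    then show ?thesis
      using u by (auto simp: available_nbrs_def available_insert)
  qed
  have "freedom k G (insert (x, i) \<phi>) + card (available_nbrs k G \<phi> x i) = freedom k G \<phi>"
  proof -
    have "card (available_nbrs k G \<phi> x i) =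
        (\<Sum>u\<in>verts G. if u \<in> available_nbrs k G \<phi> x i then 1 else 0)"
      using fin by (auto simp: available_nbrs_def sum.If_cases Int_def)
    then show ?thesis
      using split unfolding freedom_def by (simp add: sum.distrib[symmetric] cong: sum.cong)
  qed
  moreover have "\<epsilon> / 2 * real (card (verts G)) \<le> real (card (available_nbrs k G \<phi> x i))"
    using x i by (auto simp: restricting_def)
  ultimately show ?thesis
    by linarith
qed

section \<open>Random samples of far graphs\<close>

definition extendable :: "nat \<Rightarrow> ugraph \<Rightarrow> (nat \<times> nat) set \<Rightarrow> nat list \<Rightarrow> bool" where
  "extendable k G \<phi> xs \<longleftrightarrow>
     (\<exists>c. proper_on k G (fst ` \<phi> \<union> set xs) c \<and> (\<forall>(v, i)\<in>\<phi>. c v = i))"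

lemma extendable_ConsD:
  assumes "extendable k G \<phi> (x # xs)"
  shows "extendable k G \<phi> xs"
proof -
  obtain c where c: "proper_on k G (fst ` \<phi> \<union> set (x # xs)) c" "\<forall>(v, i)\<in>\<phi>. c v = i"
    using assms unfolding extendable_def by blast
  have "proper_on k G (fst ` \<phi> \<union> set xs) c"
    by (rule proper_on_subset[OF c(1)]) auto
  then show ?thesis
    unfolding extendable_def using c(2) by blast
qed

lemma extendable_Cons_cases:
  assumes "extendable k G \<phi> (x # xs)"
  shows "\<exists>i\<in>available k G \<phi> x. extendable k G (insert (x, i) \<phi>) xs"
proof -
  obtain c where c: "proper_on k G (fst ` \<phi> \<union> set (x # xs)) c" "\<forall>(v, i)\<in>\<phi>. c v = i"
    using assms unfolding extendable_def by blast
  have "c x < k"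
    using c(1) by (simp add: proper_on_def)
  moreover have "\<not> adjacent G x v" if "(v, c x) \<in> \<phi>" for v
  proof
    assume "adjacent G x v"
    moreover have "v \<in> fst ` \<phi>"
      using that by (rule image_eqI[rotated]) simp
    ultimately have "c x \<noteq> c v"
      using c(1) by (simp add: proper_on_def)
    then show False
      using that c(2) by blast
  qed
  ultimately have "c x \<in> available k G \<phi> x"
    by (auto simp: available_def)
  moreover have "fst ` insert (x, c x) \<phi> \<union> set xs = fst ` \<phi> \<union> set (x # xs)"
    by simp
  then have "extendable k G (insert (x, c x) \<phi>) xs"
    unfolding extendable_def using c by (intro exI[of _ c]) simp
  ultimately show ?thesis
    by blast
qed

lemma prob_replicate_Suc:
  fixes V :: "'a set"
  assumes "finite V" "V \<noteq> {}"
  shows "measure_pmf.prob (replicate_pmf (Suc m) (pmf_of_set V)) {xs. Q xs} =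
    (\<Sum>x\<in>V. measure_pmf.prob (replicate_pmf m (pmf_of_set V)) {xs. Q (x # xs)}) / real (card V)"
proof -
  let ?R = "replicate_pmf m (pmf_of_set V)"
  have fin: "finite (set_pmf ?R)"
    using assms finite_lists_length_eq[of V m]
    by (simp add: set_replicate_pmf lists_eq_set)
  have eq: "replicate_pmf (Suc m) (pmf_of_set V) = pmf_of_set V \<bind> (\<lambda>x. map_pmf ((#) x) ?R)"
    by (simp add: map_pmf_def)
  have "measure_pmf.prob (replicate_pmf (Suc m) (pmf_of_set V)) {xs. Q xs} =
      measure_pmf.expectation (replicate_pmf (Suc m) (pmf_of_set V)) (indicat_real {xs. Q xs})"
    by simp
  also have "\<dots> = (\<Sum>x\<in>V. measure_pmf.expectation (map_pmf ((#) x) ?R) (indicat_real {xs. Q xs})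
      /\<^sub>R real (card V))"
    unfolding eq using assms fin by (intro pmf_expectation_bind_pmf_of_set) auto
  also have "\<dots> = (\<Sum>x\<in>V. measure_pmf.prob ?R {xs. Q (x # xs)} / real (card V))"
    by (intro sum.cong refl) (simp add: vimage_def field_simps del: integral_map_pmf)
  finally show ?thesis
    by (simp add: sum_divide_distrib)
qed

text \<open>The exponent \<open>2 freedom / (\<epsilon>n)\<close> bounds how often a colour can still be recorded at a
  restricting vertex. In the induction on the sample size, a restricting first vertex costs a union
  bound over at most \<open>k\<close> colours and lowers the exponent by \<open>1\<close>, which leaves a factor
  \<open>k / (2k) = 1/2\<close>; any other first vertex is ignored. Averaging over the first vertex gives
  \<open>1 - \<epsilon>/4\<close>, because it is restricting with probability at least \<open>\<epsilon>/2\<close>.\<close>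

lemma prob_extendable_le:
  assumes G: "simple_graph G" and k: "k \<ge> 1" and pos: "\<epsilon> > 0" and lt1: "\<epsilon> < 1"
    and far: "eps_far (colourable k) \<epsilon> G" and ne: "verts G \<noteq> {}"
  shows "measure_pmf.prob (replicate_pmf m (pmf_of_set (verts G))) {xs. extendable k G \<phi> xs}
    \<le> (2 * real k) powr (real (freedom k G \<phi>) / (\<epsilon> / 2 * real (card (verts G)))) * (1 - \<epsilon> / 4) ^ m"
proof (induction m arbitrary: \<phi>)
  case 0
  have "1 \<le> (2 * real k) powr (real (freedom k G \<phi>) / (\<epsilon> / 2 * real (card (verts G))))"
    using k pos by (intro ge_one_powr_ge_zero) auto
  then show ?case
    by (simp add: order_trans[OF measure_pmf.prob_le_1] del: replicate_pmf.simps)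
next
  case (Suc m)
  let ?V = "verts G" and ?W = "restricting k \<epsilon> G \<phi>"
  let ?R = "replicate_pmf m (pmf_of_set ?V)"
  define n where "n = real (card ?V)"
  define B where "B \<phi> = (2 * real k) powr (real (freedom k G \<phi>) / (\<epsilon> / 2 * n))" for \<phi>
  define r where "r = (1 - \<epsilon> / 4) ^ m"
  have fin: "finite ?V"
    using G by (simp add: simple_graph_def)
  have n: "n > 0"
    using ne fin by (simp add: n_def card_gt_0_iff)
  have r: "r \<ge> 0"
    using lt1 by (simp add: r_def)
  have IH: "measure_pmf.prob ?R {xs. extendable k G \<psi> xs} \<le> B \<psi> * r" for \<psi>
    using Suc.IH[of \<psi>] by (simp add: B_def r_def n_def)
  have WV: "?W \<subseteq> ?V"
    by (auto simp: restricting_def)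
  have outside: "measure_pmf.prob ?R {xs. extendable k G \<phi> (x # xs)} \<le> B \<phi> * r" for x
  proof -
    have "measure_pmf.prob ?R {xs. extendable k G \<phi> (x # xs)}
        \<le> measure_pmf.prob ?R {xs. extendable k G \<phi> xs}"
      by (intro measure_pmf.finite_measure_mono) (auto dest: extendable_ConsD)
    with IH[of \<phi>] show ?thesis
      by linarith
  qed
  have inside: "measure_pmf.prob ?R {xs. extendable k G \<phi> (x # xs)} \<le> B \<phi> * r / 2"
    if x: "x \<in> ?W" for x
  proof -
    have B_insert: "B (insert (x, i) \<phi>) \<le> B \<phi> / (2 * real k)" if i: "i \<in> available k G \<phi> x" for i
    proof -
      have "real (freedom k G (insert (x, i) \<phi>)) \<le> real (freedom k G \<phi>) - \<epsilon> / 2 * n"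
        using freedom_decreases[OF G x i] by (simp add: n_def)
      then have "real (freedom k G (insert (x, i) \<phi>)) / (\<epsilon> / 2 * n)
          \<le> (real (freedom k G \<phi>) - \<epsilon> / 2 * n) / (\<epsilon> / 2 * n)"
        using pos n by (intro divide_right_mono) auto
      also have "\<dots> = real (freedom k G \<phi>) / (\<epsilon> / 2 * n) - 1"
        using pos n by (simp add: field_simps)
      finally have "B (insert (x, i) \<phi>)
          \<le> (2 * real k) powr (real (freedom k G \<phi>) / (\<epsilon> / 2 * n) - 1)"
        unfolding B_def using k by (intro powr_mono) auto
      also have "\<dots> = B \<phi> / (2 * real k)"
        using k by (simp add: B_def powr_diff)
      finally show ?thesis .
    qed
    have "measure_pmf.prob ?R {xs. extendable k G \<phi> (x # xs)}
        \<le> measure_pmf.prob ?R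
            (\<Union>i\<in>available k G \<phi> x. {xs. extendable k G (insert (x, i) \<phi>) xs})"
      by (intro measure_pmf.finite_measure_mono) (auto dest: extendable_Cons_cases)
    also have "\<dots> \<le> (\<Sum>i\<in>available k G \<phi> x.
        measure_pmf.prob ?R {xs. extendable k G (insert (x, i) \<phi>) xs})"
      by (intro measure_pmf.finite_measure_subadditive_finite) auto
    also have "\<dots> \<le> (\<Sum>i\<in>available k G \<phi> x. B \<phi> / (2 * real k) * r)"
      using IH B_insert r by (intro sum_mono) (meson mult_right_mono order_trans)
    also have "\<dots> \<le> real k * (B \<phi> / (2 * real k) * r)"
      unfolding sum_constant using card_available_le r
      by (intro mult_right_mono) (auto simp: B_def)
    also have "\<dots> = B \<phi> * r / 2"
      using k by simp
    finally show ?thesis .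
  qed
  have "(\<Sum>x\<in>?V. measure_pmf.prob ?R {xs. extendable k G \<phi> (x # xs)})
      \<le> (\<Sum>x\<in>?V. if x \<in> ?W then B \<phi> * r / 2 else B \<phi> * r)"
    using inside outside by (intro sum_mono) auto
  also have "\<dots> = (\<Sum>x\<in>?V. B \<phi> * r - (if x \<in> ?W then B \<phi> * r / 2 else 0))"
    by (intro sum.cong) auto
  also have "\<dots> = n * (B \<phi> * r) - real (card ?W) * (B \<phi> * r / 2)"
    using fin WV by (simp add: sum_subtractf sum.If_cases n_def Int_absorb1)
  also have "\<dots> \<le> n * (B \<phi> * r) - (\<epsilon> / 2 * n) * (B \<phi> * r / 2)"
    using many_restricting[OF G k pos far, of \<phi>] r
    by (intro diff_left_mono mult_right_mono) (auto simp: n_def B_def)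
  finally have "(\<Sum>x\<in>?V. measure_pmf.prob ?R {xs. extendable k G \<phi> (x # xs)}) / n
      \<le> (n * (B \<phi> * r) - (\<epsilon> / 2 * n) * (B \<phi> * r / 2)) / n"
    using n by (intro divide_right_mono) auto
  also have "\<dots> = B \<phi> * ((1 - \<epsilon> / 4) * r)"
    using n by (simp add: field_simps)
  finally show ?case
    using prob_replicate_Suc[OF fin ne, of m "extendable k G \<phi>"]
    by (simp add: n_def B_def r_def)
qed

definition sample_size :: "nat \<Rightarrow> real \<Rightarrow> nat" where
  "sample_size k \<epsilon> = nat \<lceil>16 * real k ^ 2 / \<epsilon> ^ 2\<rceil>"

text \<open>As \<open>ln (2k) \<le> 2k - 1\<close>, the exponent \<open>2k/\<epsilon> \<cdot> ln (2k) - \<epsilon>s/4\<close> is at most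
  \<open>2k(2k - 1)/\<epsilon> - 4k\<^sup>2/\<epsilon> = -2k/\<epsilon> \<le> -2\<close>.\<close>

lemma sample_size_suffices:
  assumes k: "k \<ge> 1" and pos: "\<epsilon> > 0" and lt1: "\<epsilon> < 1"
  shows "(2 * real k) powr (2 * real k / \<epsilon>) * (1 - \<epsilon> / 4) ^ sample_size k \<epsilon> \<le> 1 / 3"
proof -
  define s where "s = real (sample_size k \<epsilon>)"
  have s: "16 * real k ^ 2 / \<epsilon> ^ 2 \<le> s"
    unfolding s_def sample_size_def by (rule real_nat_ceiling_ge)
  have "(2 * real k) powr (2 * real k / \<epsilon>) = exp (2 * real k / \<epsilon> * ln (2 * real k))"
    using k by (simp add: powr_def)
  also have "\<dots> \<le> exp (2 * real k / \<epsilon> * (2 * real k - 1))"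
    using k pos ln_le_minus_one[of "2 * real k"]
    by (subst exp_le_cancel_iff, intro mult_left_mono) auto
  finally have 1: "(2 * real k) powr (2 * real k / \<epsilon>) \<le> exp (2 * real k / \<epsilon> * (2 * real k - 1))" .
  have "(1 - \<epsilon> / 4) ^ sample_size k \<epsilon> \<le> exp (- \<epsilon> / 4) ^ sample_size k \<epsilon>"
    using lt1 exp_ge_add_one_self[of "- \<epsilon> / 4"] by (intro power_mono) auto
  also have "\<dots> = exp (s * (- \<epsilon> / 4))"
    unfolding s_def by (rule exp_of_nat_mult[symmetric])
  also have "\<dots> \<le> exp (16 * real k ^ 2 / \<epsilon> ^ 2 * (- \<epsilon> / 4))"
    using s pos by (subst exp_le_cancel_iff, intro mult_right_mono_neg) auto
  also have "16 * real k ^ 2 / \<epsilon> ^ 2 * (- \<epsilon> / 4) = - 4 * real k ^ 2 / \<epsilon>"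
    using pos by (simp add: field_simps power2_eq_square)
  finally have 2: "(1 - \<epsilon> / 4) ^ sample_size k \<epsilon> \<le> exp (- 4 * real k ^ 2 / \<epsilon>)" .
  have "(2 * real k) powr (2 * real k / \<epsilon>) * (1 - \<epsilon> / 4) ^ sample_size k \<epsilon>
      \<le> exp (2 * real k / \<epsilon> * (2 * real k - 1)) * exp (- 4 * real k ^ 2 / \<epsilon>)"
    using 1 2 lt1 by (intro mult_mono) auto
  also have "\<dots> = exp (- (2 * real k / \<epsilon>))"
    using pos by (simp add: exp_add[symmetric] field_simps power2_eq_square)
  also have "\<dots> \<le> exp (- 2)"
  proof -
    have "2 * \<epsilon> \<le> 2 * real k"
      using k lt1 by simp
    then show ?thesis
      using pos by (simp add: field_simps)
  qed
  also have "\<dots> \<le> 1 / 3"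
    using exp_ge_add_one_self[of 2] by (simp add: exp_minus field_simps)
  finally show ?thesis .
qed

lemma prob_sample_colourable_le:
  assumes G: "simple_graph G" and k: "k \<ge> 1" and pos: "\<epsilon> > 0" and lt1: "\<epsilon> < 1"
    and far: "eps_far (colourable k) \<epsilon> G"
  shows "measure_pmf.prob (sample_answer G (sample_size k \<epsilon>)) {xs. \<exists>c. proper_on k G (set xs) c}
           \<le> 1 / 3"
proof (cases "sample_size k \<epsilon> > card (verts G)")
  case True
  have "finite (verts G)"
    using G by (simp add: simple_graph_def)
  moreover have "\<not> (\<exists>c. proper_on k G (verts G) c)"
    using not_colourable_if_eps_far[OF G pos far] by (simp add: colourable_iff_proper_on)
  ultimately show ?thesis
    using True by (simp add: sample_answer_def)
next
  case False
  have "16 * real k ^ 2 / \<epsilon> ^ 2 > 0"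
    using k pos by simp
  then have "sample_size k \<epsilon> > 0"
    by (simp add: sample_size_def)
  then have ne: "verts G \<noteq> {}"
    using False by auto
  have fin: "finite (verts G)"
    using G by (simp add: simple_graph_def)
  have "freedom k G {} = k * card (verts G)"
    by (simp add: freedom_def available_def)
  then have "real (freedom k G {}) / (\<epsilon> / 2 * real (card (verts G))) = 2 * real k / \<epsilon>"
    using ne fin by (simp add: field_simps)
  moreover have "extendable k G {} xs \<longleftrightarrow> (\<exists>c. proper_on k G (set xs) c)" for xs
    by (simp add: extendable_def)
  ultimately have "measure_pmf.prob (sample_answer G (sample_size k \<epsilon>))
        {xs. \<exists>c. proper_on k G (set xs) c}
      \<le> (2 * real k) powr (2 * real k / \<epsilon>) * (1 - \<epsilon> / 4) ^ sample_size k \<epsilon>"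
    using prob_extendable_le[OF G k pos lt1 far ne, of "sample_size k \<epsilon>" "{}"] False
    by (simp add: sample_answer_def)
  also have "\<dots> \<le> 1 / 3"
    by (rule sample_size_suffices[OF k pos lt1])
  finally show ?thesis .
qed

section \<open>The tester\<close>

primrec query_pairs :: "(nat \<times> nat) list \<Rightarrow> nat set set \<Rightarrow> (nat set set \<Rightarrow> bool) \<Rightarrow> oracle_alg" where
  "query_pairs [] E f = Halt (f E)"
| "query_pairs (p # ps) E f =
     Query (fst p) (snd p) (\<lambda>b. query_pairs ps (if b then insert {fst p, snd p} E else E) f)"

lemma run_query_pairs:
  "run G (query_pairs ps E f) =
     return_pmf (f (E \<union> {{u, v} | u v. (u, v) \<in> set ps \<and> adjacent G u v}), length ps, 0)"
proof (induction ps arbitrary: E)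
  case (Cons p ps)
  obtain u v where p: "p = (u, v)"
    by (cases p)
  have "(if adjacent G u v then insert {u, v} E else E)
        \<union> {{u, v} | u v. (u, v) \<in> set ps \<and> adjacent G u v}
      = E \<union> {{u, v} | u v. (u, v) \<in> set (p # ps) \<and> adjacent G u v}"
    unfolding p by auto
  moreover have "run G (query_pairs (p # ps) E f) =
      map_pmf (\<lambda>(b, q, l). (b, Suc q, l))
        (return_pmf (f ((if adjacent G u v then insert {u, v} E else E)
           \<union> {{u, v} | u v. (u, v) \<in> set ps \<and> adjacent G u v}), length ps, 0))"
    by (simp only: p query_pairs.simps run.simps fst_conv snd_conv Cons.IH)
  ultimately have "run G (query_pairs (p # ps) E f) =
      map_pmf (\<lambda>(b, q, l). (b, Suc q, l))
        (return_pmf (f (E \<union> {{u, v} | u v. (u, v) \<in> set (p # ps) \<and> adjacent G u v}),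
           length ps, 0))"
    by (simp only:)
  then show ?case
    by (simp only: map_return_pmf prod.case list.size add_Suc_right add_0_right)
qed simp

definition colouring_tester :: "nat \<Rightarrow> real \<Rightarrow> oracle_alg" where
  "colouring_tester k \<epsilon> =
     (if \<epsilon> \<ge> 1 then Halt True
      else Sample (sample_size k \<epsilon>)
             (\<lambda>xs. query_pairs (List.product xs xs) {} (\<lambda>E. colourable k (set xs, E))))"

lemma run_colouring_tester:
  assumes "\<epsilon> < 1"
  shows "run G (colouring_tester k \<epsilon>) =
    map_pmf (\<lambda>xs. (\<exists>c. proper_on k G (set xs) c, length xs * length xs, length xs))
      (sample_answer G (sample_size k \<epsilon>))"
proof -
  have "colourable k (S, {{u, v} | u v. (u, v) \<in> S \<times> S \<and> adjacent G u v})
      \<longleftrightarrow> (\<exists>c. proper_on k G S c)" for S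
  proof -
    have "adjacent (S, {{u, v} | u v. (u, v) \<in> S \<times> S \<and> adjacent G u v}) a b
        \<longleftrightarrow> adjacent G a b" if "a \<in> S" "b \<in> S" for a b
      using that by (auto simp: adjacent_def doubleton_eq_iff insert_commute)
    then show ?thesis
      by (auto simp: colourable_iff_proper_on proper_on_def)
  qed
  then show ?thesis
    using assms by (simp add: colouring_tester_def run_query_pairs map_pmf_def bind_return_pmf)
qed

lemma length_sample_answer:
  assumes "simple_graph G" "xs \<in> set_pmf (sample_answer G s)"
  shows "length xs \<le> s"
  using assms by (auto simp: sample_answer_def set_replicate_pmf split: if_splits)

lemma set_sample_answer:
  assumes G: "simple_graph G" and s: "s > 0" and xs: "xs \<in> set_pmf (sample_answer G s)"
  shows "set xs \<subseteq> verts G"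
proof -
  have fin: "finite (verts G)"
    using G by (simp add: simple_graph_def)
  show ?thesis
  proof (cases "s > card (verts G)")
    case True
    then show ?thesis
      using xs fin by (simp add: sample_answer_def)
  next
    case False
    then have "verts G \<noteq> {}"
      using s by auto
    then show ?thesis
      using False xs fin by (auto simp: sample_answer_def set_replicate_pmf)
  qed
qed

lemma colouring_tester_counts:
  assumes "simple_graph G" "(b, q, l) \<in> set_pmf (run G (colouring_tester k \<epsilon>))"
  shows "q \<le> (if \<epsilon> \<ge> 1 then 0 else (sample_size k \<epsilon>)\<^sup>2)" "l \<le> sample_size k \<epsilon>"
proof -
  show "q \<le> (if \<epsilon> \<ge> 1 then 0 else (sample_size k \<epsilon>)\<^sup>2)"
  proof (cases "\<epsilon> \<ge> 1")
    case True
    then show ?thesis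
      using assms by (simp add: colouring_tester_def)
  next
    case False
    then show ?thesis
      using assms
      by (auto simp: run_colouring_tester power2_eq_square intro!: mult_mono length_sample_answer)
  qed
  show "l \<le> sample_size k \<epsilon>"
  proof (cases "\<epsilon> \<ge> 1")
    case True
    then show ?thesis
      using assms by (simp add: colouring_tester_def)
  next
    case False
    then show ?thesis
      using assms by (auto simp: run_colouring_tester intro: length_sample_answer)
  qed
qed

lemma query_complexity_colouring_tester:
  "query_complexity (colouring_tester k \<epsilon>) \<le> (if \<epsilon> \<ge> 1 then 0 else (sample_size k \<epsilon>)\<^sup>2)"
proof -
  \<comment> \<open>The empty graph witnesses that the supremum is over a nonempty set.\<close>
  have "simple_graph ({}, {})"
    by (simp add: simple_graph_def)
  moreover obtain b q l where "(b, q, l) \<in> set_pmf (run ({}, {}) (colouring_tester k \<epsilon>))"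
    by (metis all_not_in_conv prod_cases3 set_pmf_not_empty)
  ultimately have "query_counts (colouring_tester k \<epsilon>) \<noteq> {}"
    unfolding query_counts_def by blast
  then show ?thesis
    unfolding query_complexity_def
    by (rule cSup_least) (use colouring_tester_counts(1) in \<open>unfold query_counts_def, blast\<close>)
qed

lemma accept_prob_colourable:
  assumes G: "simple_graph G" and k: "k \<ge> 1" and pos: "\<epsilon> > 0" and col: "colourable k G"
  shows "accept_prob (colouring_tester k \<epsilon>) G = 1"
proof (cases "\<epsilon> \<ge> 1")
  case True
  then show ?thesis
    by (simp add: accept_prob_def colouring_tester_def)
next
  case False
  have "16 * real k ^ 2 / \<epsilon> ^ 2 > 0"
    using k pos by simp
  then have s: "sample_size k \<epsilon> > 0"
    by (simp add: sample_size_def)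
  obtain c where c: "proper_on k G (verts G) c"
    using col by (auto simp: colourable_iff_proper_on)
  have "\<exists>c. proper_on k G (set xs) c" if "xs \<in> set_pmf (sample_answer G (sample_size k \<epsilon>))" for xs
    using proper_on_subset[OF c set_sample_answer[OF G s that]] by blast
  then show ?thesis
    using False unfolding accept_prob_def
    by (subst measure_pmf.prob_eq_1) (auto simp: AE_measure_pmf_iff run_colouring_tester)
qed

lemma reject_prob_eps_far:
  assumes G: "simple_graph G" and k: "k \<ge> 1" and pos: "\<epsilon> > 0"
    and far: "eps_far (colourable k) \<epsilon> G"
  shows "reject_prob (colouring_tester k \<epsilon>) G \<ge> 2 / 3"
proof -
  have lt1: "\<epsilon> < 1"
    using not_eps_far_if_ge_1[OF G k, of \<epsilon>] far by (cases "\<epsilon> < 1") simp_all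
  let ?p = "sample_answer G (sample_size k \<epsilon>)" and ?A = "{xs. \<exists>c. proper_on k G (set xs) c}"
  have "reject_prob (colouring_tester k \<epsilon>) G = measure_pmf.prob ?p (- ?A)"
    unfolding reject_prob_def run_colouring_tester[OF lt1] measure_map_pmf
    by (rule arg_cong[where f = "measure_pmf.prob ?p"]) auto
  also have "\<dots> = 1 - measure_pmf.prob ?p ?A"
    using measure_pmf.prob_compl[of ?A ?p] by (simp add: Compl_eq_Diff_UNIV)
  finally show ?thesis
    using prob_sample_colourable_le[OF G k pos lt1 far] by linarith
qed

text \<open>Rounding up costs at most \<open>1 \<le> (k/\<epsilon>)\<^sup>2\<close>.\<close>

lemma sample_size_le:
  assumes k: "k \<ge> 1" and pos: "\<epsilon> > 0" and lt1: "\<epsilon> < 1"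
  shows "real (sample_size k \<epsilon>) \<le> 17 * (real k / \<epsilon>) ^ 2"
proof -
  have "1 \<le> (real k / \<epsilon>) ^ 2"
    using assms by (intro one_le_power) (simp add: field_simps)
  moreover have "real (sample_size k \<epsilon>) \<le> 16 * (real k / \<epsilon>) ^ 2 + 1"
    unfolding sample_size_def using ceiling_correct[of "16 * real k ^ 2 / \<epsilon> ^ 2"]
    by (simp add: power_divide of_nat_nat)
  ultimately show ?thesis
    by linarith
qed

theorem corollary5p4:
  shows "\<exists>T :: nat \<Rightarrow> real \<Rightarrow> oracle_alg.
    (\<forall>k\<ge>1. size_oblivious_tester (colourable k) (T k) \<and> one_sided_error (colourable k) (T k)) \<and>
    soft_O_on {(k, \<epsilon>). k \<ge> 1 \<and> \<epsilon> > 0}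
      (\<lambda>(k, \<epsilon>). real (query_complexity (T k \<epsilon>)))
      (\<lambda>(k, \<epsilon>). real k ^ 6 / \<epsilon> ^ 6)"
proof (intro exI[of _ colouring_tester] conjI allI impI)
  fix k :: nat
  assume k: "k \<ge> 1"
  have "bdd_above (query_counts (colouring_tester k \<epsilon>))" for \<epsilon>
    by (rule bdd_aboveI[of _ "if \<epsilon> \<ge> 1 then 0 else (sample_size k \<epsilon>)\<^sup>2"])
      (use colouring_tester_counts(1) in \<open>unfold query_counts_def, blast\<close>)
  moreover have "bdd_above (sample_counts (colouring_tester k \<epsilon>))" for \<epsilon>
    by (rule bdd_aboveI[of _ "sample_size k \<epsilon>"])
      (use colouring_tester_counts(2) in \<open>unfold sample_counts_def, blast\<close>)
  ultimately show "size_oblivious_tester (colourable k) (colouring_tester k)"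
    using accept_prob_colourable[OF _ k] reject_prob_eps_far[OF _ k]
    by (simp add: size_oblivious_tester_def)
  show "one_sided_error (colourable k) (colouring_tester k)"
    using accept_prob_colourable[OF _ k] by (simp add: one_sided_error_def)
next
  have bound: "real (query_complexity (colouring_tester k \<epsilon>)) \<le> 289 * (real k ^ 6 / \<epsilon> ^ 6)"
    if k: "k \<ge> 1" and pos: "\<epsilon> > 0" for k :: nat and \<epsilon> :: real
  proof (cases "\<epsilon> \<ge> 1")
    case True
    then show ?thesis
      using query_complexity_colouring_tester[of k \<epsilon>] by simp
  next
    case False
    have "real (query_complexity (colouring_tester k \<epsilon>)) \<le> real ((sample_size k \<epsilon>)\<^sup>2)"
      using query_complexity_colouring_tester[of k \<epsilon>] False by (simp del: of_nat_power)
    also have "\<dots> \<le> (17 * (real k / \<epsilon>) ^ 2) ^ 2"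
      using sample_size_le[OF k pos] False unfolding of_nat_power by (intro power_mono) auto
    also have "\<dots> = 289 * (real k / \<epsilon>) ^ 4"
      by (simp add: power_mult_distrib flip: power_mult)
    \<comment> \<open>In the case at hand \<open>k/\<epsilon> \<ge> 1\<close>.\<close>
    also have "\<dots> \<le> 289 * (real k / \<epsilon>) ^ 6"
      using k pos False by (intro mult_left_mono power_increasing) (auto simp: field_simps)
    finally show ?thesis
      by (simp add: power_divide)
  qed
  show "soft_O_on {(k, \<epsilon>). k \<ge> 1 \<and> \<epsilon> > 0}
      (\<lambda>(k, \<epsilon>). real (query_complexity (colouring_tester k \<epsilon>)))
      (\<lambda>(k, \<epsilon>). real k ^ 6 / \<epsilon> ^ 6)"
    unfolding soft_O_on_def
    by (intro exI[of _ 289] exI[of _ "0::nat"]) (use bound in auto)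
qed

end
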